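(* Let $G$ and $H$ be locally compact Hausdorff groupoids with open range and source maps, let $Z$ be a $(G,H)$-equivalence with moment maps $r:Z\to G^{(0)}$ and $s:Z\to H^{(0)}$, and let $z\in Z$. Then the isotropy of $G$ is continuous at $r(z)$ if and only if the isotropy of $H$ is continuous at $s(z)$.
   Context: Groupoids are topological groupoids, not assumed second countable and not assumed to have Haar systems. $G^{(0)}$ is the unit space of $G$, and $r,s:G\to G^{(0)}$ are the range and source maps. Actions: a left action of $G$ on a space $P$ consists of a continuous moment map $r_P:P\to G^{(0)}$ and a continuous map $(\gamma,p)\mapsto\gamma\cdot p$ from $G*P=\{(\gamma,p): s(\gamma)=r_P(p)\}$ to $P$ with $r_P(\gamma\cdot p)=r(\gamma)$, $r_P(p)\cdot p=p$ and $\gamma\cdot(\eta\cdot p)=(\gamma\eta)\cdot p$ for composable $\gamma,\eta$. The action is free if $\gamma\cdot p=p$ only when $\gamma=r_P(p)$. It is proper if the map $\Theta:G*P\to P\times P$, $\Theta(\gamma,p)=(\gamma\cdot p,p)$, is proper (preimages of compact sets are compact). Right actions are defined similarly, with moment map $s_P$. A $(G,H)$-equivalence is a locally compact Hausdorff space $Z$ such that: (E1) $Z$ is a free and proper left $G$-space; (E2) $Z$ is a free and proper right $H$-space; (E3) the two actions commute; (E4) the moment map $r_Z:Z\to G^{(0)}$ is open and induces a homeomorphism $Z/H\to G^{(0)}$; (E5) the moment map $s_Z:Z\to H^{(0)}$ is open and induces a homeomorphism $G\backslash Z\to H^{(0)}$. (The subscripts $Z$ are dropped in the claim.) For $u\in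 G^{(0)}$ the isotropy group is $G(u)=\{\gamma\in G: r(\gamma)=u=s(\gamma)\}$. Let $\Sigma_0$ be the set of closed subgroups of $G$, i.e. closed subsets of $G$ that are subgroups of $G(u)$ for some $u\in G^{(0)}$, with the relative topology from the Fell topology on the set $\mathcal C(G)$ of all closed subsets of $G$ (basic open sets: $\{F\in\mathcal C(G): F\cap K=\emptyset,\ F\cap U_i\neq\emptyset\ (1\le i\le n)\}$ with $K\subset G$ compact and $U_1,\dots,U_n\subset G$ open). The isotropy of $G$ is continuous at $u\in G^{(0)}$ if $G(u_n)\to G(u)$ in $\Sigma_0$ for every net $(u_n)$ in $G^{(0)}$ converging to $u$. *)

theory Defs
  imports "HOL-Analysis.Analysis"
begin

section \<open>Topological groupoids\<close>

text \<open>A groupoid is given by its arrows, i.e. the points of \<open>arrow_top\<close>; units are arrows.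
  The multiplication is only meaningful on composable pairs.\<close>

record 'a groupoid =
  arrow_top :: "'a topology"
  rng :: "'a \<Rightarrow> 'a"
  src :: "'a \<Rightarrow> 'a"
  mul :: "'a \<Rightarrow> 'a \<Rightarrow> 'a"
  ginv :: "'a \<Rightarrow> 'a"

definition arrows :: "'a groupoid \<Rightarrow> 'a set" where
  "arrows G = topspace (arrow_top G)"

definition units :: "'a groupoid \<Rightarrow> 'a set" where
  "units G = rng G ` arrows G"

definition unit_space :: "'a groupoid \<Rightarrow> 'a topology" where
  "unit_space G = subtopology (arrow_top G) (units G)"

definition composable :: "'a groupoid \<Rightarrow> ('a \<times> 'a) set" where
  "composable G = {(\<gamma>, \<eta>). \<gamma> \<in> arrows G \<and> \<eta> \<in> arrows G \<and> src G \<gamma> = rng G \<eta>}"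

locale groupoid =
  fixes G :: "'a groupoid"
  assumes rng_closed: "\<gamma> \<in> arrows G \<Longrightarrow> rng G \<gamma> \<in> arrows G"
    and src_closed: "\<gamma> \<in> arrows G \<Longrightarrow> src G \<gamma> \<in> arrows G"
    and rng_rng: "\<gamma> \<in> arrows G \<Longrightarrow> rng G (rng G \<gamma>) = rng G \<gamma>"
    and src_rng: "\<gamma> \<in> arrows G \<Longrightarrow> src G (rng G \<gamma>) = rng G \<gamma>"
    and rng_src: "\<gamma> \<in> arrows G \<Longrightarrow> rng G (src G \<gamma>) = src G \<gamma>"
    and src_src: "\<gamma> \<in> arrows G \<Longrightarrow> src G (src G \<gamma>) = src G \<gamma>"
    and mul_closed: "(\<gamma>, \<eta>) \<in> composable G \<Longrightarrow> mul G \<gamma> \<eta> \<in> arrows G"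
    and rng_mul: "(\<gamma>, \<eta>) \<in> composable G \<Longrightarrow> rng G (mul G \<gamma> \<eta>) = rng G \<gamma>"
    and src_mul: "(\<gamma>, \<eta>) \<in> composable G \<Longrightarrow> src G (mul G \<gamma> \<eta>) = src G \<eta>"
    and mul_assoc: "(\<gamma>, \<eta>) \<in> composable G \<Longrightarrow> (\<eta>, \<zeta>) \<in> composable G \<Longrightarrow>
      mul G (mul G \<gamma> \<eta>) \<zeta> = mul G \<gamma> (mul G \<eta> \<zeta>)"
    and rng_mul_id: "\<gamma> \<in> arrows G \<Longrightarrow> mul G (rng G \<gamma>) \<gamma> = \<gamma>"
    and mul_src_id: "\<gamma> \<in> arrows G \<Longrightarrow> mul G \<gamma> (src G \<gamma>) = \<gamma>"
    and inv_closed: "\<gamma> \<in> arrows G \<Longrightarrow> ginv G \<gamma> \<in> arrows G"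
    and rng_inv: "\<gamma> \<in> arrows G \<Longrightarrow> rng G (ginv G \<gamma>) = src G \<gamma>"
    and src_inv: "\<gamma> \<in> arrows G \<Longrightarrow> src G (ginv G \<gamma>) = rng G \<gamma>"
    and mul_inv: "\<gamma> \<in> arrows G \<Longrightarrow> mul G \<gamma> (ginv G \<gamma>) = rng G \<gamma>"
    and inv_mul: "\<gamma> \<in> arrows G \<Longrightarrow> mul G (ginv G \<gamma>) \<gamma> = src G \<gamma>"

locale topological_groupoid = groupoid +
  assumes continuous_rng: "continuous_map (arrow_top G) (unit_space G) (rng G)"
    and continuous_src: "continuous_map (arrow_top G) (unit_space G) (src G)"
    and continuous_inv: "continuous_map (arrow_top G) (arrow_top G) (ginv G)"
    and continuous_mul:
      "continuous_map (subtopology (prod_topology (arrow_top G) (arrow_top G)) (composable G))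
        (arrow_top G) (\<lambda>(\<gamma>, \<eta>). mul G \<gamma> \<eta>)"


section \<open>Actions and equivalences\<close>

text \<open>This is properness in the sense that preimages of compact sets are compact; the library's
  \<open>proper_map\<close> instead asks for a closed map with compact fibres.\<close>

definition compact_preimages :: "'a topology \<Rightarrow> 'b topology \<Rightarrow> ('a \<Rightarrow> 'b) \<Rightarrow> bool" where
  "compact_preimages X Y f \<longleftrightarrow> (\<forall>K. compactin Y K \<longrightarrow> compactin X {x \<in> topspace X. f x \<in> K})"

definition left_fibre_product :: "'g groupoid \<Rightarrow> 'p topology \<Rightarrow> ('p \<Rightarrow> 'g) \<Rightarrow> ('g \<times> 'p) topology" where
  "left_fibre_product G P \<rho> =
    subtopology (prod_topology (arrow_top G) P) {(\<gamma>, p). src G \<gamma> = \<rho> p}"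

definition right_fibre_product :: "'h groupoid \<Rightarrow> 'p topology \<Rightarrow> ('p \<Rightarrow> 'h) \<Rightarrow> ('p \<times> 'h) topology" where
  "right_fibre_product H P \<sigma> =
    subtopology (prod_topology P (arrow_top H)) {(p, \<eta>). \<sigma> p = rng H \<eta>}"

locale left_action =
  fixes G :: "'g groupoid" and P :: "'p topology" and \<rho> :: "'p \<Rightarrow> 'g" and act :: "'g \<Rightarrow> 'p \<Rightarrow> 'p"
  assumes moment_continuous: "continuous_map P (unit_space G) \<rho>"
    and act_continuous: "continuous_map (left_fibre_product G P \<rho>) P (\<lambda>(\<gamma>, p). act \<gamma> p)"
    and moment_act: "\<gamma> \<in> arrows G \<Longrightarrow> p \<in> topspace P \<Longrightarrow> src G \<gamma> = \<rho> p \<Longrightarrow>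
      \<rho> (act \<gamma> p) = rng G \<gamma>"
    and act_unit: "p \<in> topspace P \<Longrightarrow> act (\<rho> p) p = p"
    and act_mul: "(\<gamma>, \<eta>) \<in> composable G \<Longrightarrow> p \<in> topspace P \<Longrightarrow> src G \<eta> = \<rho> p \<Longrightarrow>
      act \<gamma> (act \<eta> p) = act (mul G \<gamma> \<eta>) p"

locale free_proper_left_action = left_action +
  assumes free: "\<gamma> \<in> arrows G \<Longrightarrow> p \<in> topspace P \<Longrightarrow> src G \<gamma> = \<rho> p \<Longrightarrow> act \<gamma> p = p \<Longrightarrow> \<gamma> = \<rho> p"
    and proper: "compact_preimages (left_fibre_product G P \<rho>) (prod_topology P P)
      (\<lambda>(\<gamma>, p). (act \<gamma> p, p))"

locale right_action =
  fixes H :: "'h groupoid" and P :: "'p topology" and \<sigma> :: "'p \<Rightarrow> 'h" and act :: "'p \<Rightarrow> 'h \<Rightarrow> 'p"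
  assumes moment_continuous: "continuous_map P (unit_space H) \<sigma>"
    and act_continuous: "continuous_map (right_fibre_product H P \<sigma>) P (\<lambda>(p, \<eta>). act p \<eta>)"
    and moment_act: "\<eta> \<in> arrows H \<Longrightarrow> p \<in> topspace P \<Longrightarrow> \<sigma> p = rng H \<eta> \<Longrightarrow>
      \<sigma> (act p \<eta>) = src H \<eta>"
    and act_unit: "p \<in> topspace P \<Longrightarrow> act p (\<sigma> p) = p"
    and act_mul: "(\<gamma>, \<eta>) \<in> composable H \<Longrightarrow> p \<in> topspace P \<Longrightarrow> \<sigma> p = rng H \<gamma> \<Longrightarrow>
      act (act p \<gamma>) \<eta> = act p (mul H \<gamma> \<eta>)"

locale free_proper_right_action = right_action +
  assumes free: "\<eta> \<in> arrows H \<Longrightarrow> p \<in> topspace P \<Longrightarrow> \<sigma> p = rng H \<eta> \<Longrightarrow> act p \<eta> = p \<Longrightarrow> \<eta> = \<sigma> p"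
    and proper: "compact_preimages (right_fibre_product H P \<sigma>) (prod_topology P P)
      (\<lambda>(p, \<eta>). (p, act p \<eta>))"

definition left_orbit :: "'g groupoid \<Rightarrow> ('p \<Rightarrow> 'g) \<Rightarrow> ('g \<Rightarrow> 'p \<Rightarrow> 'p) \<Rightarrow> 'p \<Rightarrow> 'p set" where
  "left_orbit G \<rho> act p = {act \<gamma> p | \<gamma>. \<gamma> \<in> arrows G \<and> src G \<gamma> = \<rho> p}"

definition right_orbit :: "'h groupoid \<Rightarrow> ('p \<Rightarrow> 'h) \<Rightarrow> ('p \<Rightarrow> 'h \<Rightarrow> 'p) \<Rightarrow> 'p \<Rightarrow> 'p set" where
  "right_orbit H \<sigma> act p = {act p \<eta> | \<eta>. \<eta> \<in> arrows H \<and> \<sigma> p = rng H \<eta>}"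

definition quotient_topology :: "'a topology \<Rightarrow> ('a \<Rightarrow> 'b) \<Rightarrow> 'b topology" where
  "quotient_topology X q =
    topology (\<lambda>V. V \<subseteq> q ` topspace X \<and> openin X {x \<in> topspace X. q x \<in> V})"

lemma openin_quotient_topology:
  "openin (quotient_topology X q) V \<longleftrightarrow>
    V \<subseteq> q ` topspace X \<and> openin X {x \<in> topspace X. q x \<in> V}"
proof -
  have "istopology (\<lambda>V. V \<subseteq> q ` topspace X \<and> openin X {x \<in> topspace X. q x \<in> V})"
    unfolding istopology_def
  proof (intro conjI allI impI)
    fix S T
    assume S: "S \<subseteq> q ` topspace X \<and> openin X {x \<in> topspace X. q x \<in> S}"
      and T: "T \<subseteq> q ` topspace X \<and> openin X {x \<in> topspace X. q x \<in> T}"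
    have "{x \<in> topspace X. q x \<in> S \<inter> T}
        = {x \<in> topspace X. q x \<in> S} \<inter> {x \<in> topspace X. q x \<in> T}" by auto
    then show "openin X {x \<in> topspace X. q x \<in> S \<inter> T}" using S T by auto
    show "S \<inter> T \<subseteq> q ` topspace X" using S by blast
  next
    fix \<K>
    assume K: "\<forall>V\<in>\<K>. V \<subseteq> q ` topspace X \<and> openin X {x \<in> topspace X. q x \<in> V}"
    have "{x \<in> topspace X. q x \<in> \<Union>\<K>} = (\<Union>V\<in>\<K>. {x \<in> topspace X. q x \<in> V})" by auto
    then show "openin X {x \<in> topspace X. q x \<in> \<Union>\<K>}" using K by auto
    show "\<Union>\<K> \<subseteq> q ` topspace X" using K by blast
  qed
  then show ?thesis unfolding quotient_topology_def by simp
qed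

lemma topspace_quotient_topology: "topspace (quotient_topology X q) = q ` topspace X"
proof
  show "topspace (quotient_topology X q) \<subseteq> q ` topspace X"
    using openin_quotient_topology[of X q "topspace (quotient_topology X q)"] by simp
  have "{x \<in> topspace X. q x \<in> q ` topspace X} = topspace X" by auto
  then have "openin (quotient_topology X q) (q ` topspace X)"
    by (simp add: openin_quotient_topology)
  then show "q ` topspace X \<subseteq> topspace (quotient_topology X q)" by (rule openin_subset)
qed

lemma quotient_map_quotient_topology: "quotient_map X (quotient_topology X q) q"
  by (auto simp: quotient_map_def openin_quotient_topology topspace_quotient_topology)

text \<open>The map \<open>f\<close> on \<open>X\<close> factors through the quotient map \<open>q\<close>, via a homeomorphism onto \<open>Y\<close>.\<close>

definition induces_homeomorphism ::
    "'a topology \<Rightarrow> ('a \<Rightarrow> 'b) \<Rightarrow> 'c topology \<Rightarrow> ('a \<Rightarrow> 'c) \<Rightarrow> bool" where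
  "induces_homeomorphism X q Y f \<longleftrightarrow>
    (\<exists>g. homeomorphic_map (quotient_topology X q) Y g \<and> (\<forall>x \<in> topspace X. g (q x) = f x))"

text \<open>Commutation includes the invariance of each moment map under the other action, without which
  the two iterated products need not be defined.\<close>

locale groupoid_equivalence =
  left: free_proper_left_action G Z r lact + right: free_proper_right_action H Z s ract
  for G :: "'g groupoid" and H :: "'h groupoid" and Z :: "'z topology"
    and r :: "'z \<Rightarrow> 'g" and s :: "'z \<Rightarrow> 'h"
    and lact :: "'g \<Rightarrow> 'z \<Rightarrow> 'z" and ract :: "'z \<Rightarrow> 'h \<Rightarrow> 'z" +
  assumes locally_compact: "locally_compact_space Z"
    and Hausdorff: "Hausdorff_space Z"
    and r_invariant: "z \<in> topspace Z \<Longrightarrow> \<eta> \<in> arrows H \<Longrightarrow> s z = rng H \<eta> \<Longrightarrow> r (ract z \<eta>) = r z"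
    and s_invariant: "z \<in> topspace Z \<Longrightarrow> \<gamma> \<in> arrows G \<Longrightarrow> src G \<gamma> = r z \<Longrightarrow> s (lact \<gamma> z) = s z"
    and actions_commute: "z \<in> topspace Z \<Longrightarrow> \<gamma> \<in> arrows G \<Longrightarrow> \<eta> \<in> arrows H \<Longrightarrow>
      src G \<gamma> = r z \<Longrightarrow> s z = rng H \<eta> \<Longrightarrow> ract (lact \<gamma> z) \<eta> = lact \<gamma> (ract z \<eta>)"
    and r_open: "open_map Z (unit_space G) r"
    and r_homeomorphism: "induces_homeomorphism Z (right_orbit H s ract) (unit_space G) r"
    and s_open: "open_map Z (unit_space H) s"
    and s_homeomorphism: "induces_homeomorphism Z (left_orbit G r lact) (unit_space H) s"


section \<open>Closed subgroups and continuity of the isotropy\<close>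

definition fell_topology :: "'a topology \<Rightarrow> 'a set topology" where
  "fell_topology X = topology_generated_by
    {{F. closedin X F \<and> F \<inter> K = {} \<and> (\<forall>U\<in>\<U>. F \<inter> U \<noteq> {})} | K \<U>.
      compactin X K \<and> finite \<U> \<and> (\<forall>U\<in>\<U>. openin X U)}"

lemma topspace_fell_topology: "topspace (fell_topology X) = {F. closedin X F}"
proof -
  let ?W = "\<lambda>K \<U>. {F. closedin X F \<and> F \<inter> K = {} \<and> (\<forall>U\<in>\<U>. F \<inter> U \<noteq> {})}"
  let ?B = "{?W K \<U> | K \<U>. compactin X K \<and> finite \<U> \<and> (\<forall>U\<in>\<U>. openin X U)}"
  have "?W {} {} \<in> ?B"
    by (intro CollectI exI[of _ "{}"] conjI) simp_all
  then have "{F. closedin X F} \<subseteq> \<Union>?B" by (intro subset_trans[OF _ Union_upper]) auto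
  moreover have "\<Union>?B \<subseteq> {F. closedin X F}" by blast
  ultimately show ?thesis
    unfolding fell_topology_def topology_generated_by_topspace by (rule subset_antisym[rotated])
qed

definition isotropy :: "'a groupoid \<Rightarrow> 'a \<Rightarrow> 'a set" where
  "isotropy G u = {\<gamma> \<in> arrows G. rng G \<gamma> = u \<and> src G \<gamma> = u}"

definition closed_subgroups :: "'a groupoid \<Rightarrow> 'a set set" where
  "closed_subgroups G = {F. closedin (arrow_top G) F \<and> (\<exists>u \<in> units G.
    F \<subseteq> isotropy G u \<and> u \<in> F \<and> (\<forall>\<gamma>\<in>F. \<forall>\<eta>\<in>F. mul G \<gamma> \<eta> \<in> F) \<and> (\<forall>\<gamma>\<in>F. ginv G \<gamma> \<in> F))}"

definition subgroup_space :: "'a groupoid \<Rightarrow> 'a set topology" where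
  "subgroup_space G = subtopology (fell_topology (arrow_top G)) (closed_subgroups G)"

text \<open>Nets are rendered, as usual in the library, by a function together with a filter on its index
  type. Index type \<open>'a\<close> suffices, since a net in the unit space can be replaced by the image filter;
  the lemmas below give arbitrary index types and the equivalence with nets over directed sets.\<close>

definition isotropy_continuous_at :: "'a groupoid \<Rightarrow> 'a \<Rightarrow> bool" where
  "isotropy_continuous_at G u \<longleftrightarrow> u \<in> units G \<and>
    (\<forall>(F :: 'a filter) x. limitin (unit_space G) x u F \<longrightarrow>
      limitin (subgroup_space G) (\<lambda>i. isotropy G (x i)) (isotropy G u) F)"

lemma isotropy_continuous_at_limitin:
  fixes F :: "'i filter"
  assumes "isotropy_continuous_at G u" and "limitin (unit_space G) x u F"
  shows "limitin (subgroup_space G) (\<lambda>i. isotropy G (x i)) (isotropy G u) F"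
proof -
  have "limitin (unit_space G) (\<lambda>v. v) u (filtermap x F)"
    using assms(2) by (simp add: limitin_def eventually_filtermap)
  then have "limitin (subgroup_space G) (isotropy G) (isotropy G u) (filtermap x F)"
    using assms(1) unfolding isotropy_continuous_at_def by blast
  then show ?thesis by (simp add: limitin_def eventually_filtermap)
qed

definition directed_set :: "'i set \<Rightarrow> ('i \<Rightarrow> 'i \<Rightarrow> bool) \<Rightarrow> bool" where
  "directed_set D le \<longleftrightarrow> D \<noteq> {} \<and> (\<forall>i\<in>D. le i i) \<and>
    (\<forall>i\<in>D. \<forall>j\<in>D. \<forall>k\<in>D. le i j \<longrightarrow> le j k \<longrightarrow> le i k) \<and> (\<forall>i\<in>D. \<forall>j\<in>D. \<exists>k\<in>D. le i k \<and> le j k)"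

definition net_converges ::
    "'a topology \<Rightarrow> 'i set \<Rightarrow> ('i \<Rightarrow> 'i \<Rightarrow> bool) \<Rightarrow> ('i \<Rightarrow> 'a) \<Rightarrow> 'a \<Rightarrow> bool" where
  "net_converges X D le x l \<longleftrightarrow> l \<in> topspace X \<and>
    (\<forall>U. openin X U \<and> l \<in> U \<longrightarrow> (\<exists>i\<in>D. \<forall>j\<in>D. le i j \<longrightarrow> x j \<in> U))"


lemma net_converges_limitin:
  assumes "directed_set D le"
  shows "net_converges X D le x l \<longleftrightarrow> limitin X x l (INF i\<in>D. principal {j \<in> D. le i j})"
proof -
  have "eventually P (INF i\<in>D. principal {j \<in> D. le i j}) \<longleftrightarrow>
      (\<exists>i\<in>D. eventually P (principal {j \<in> D. le i j}))" for P
  proof (rule eventually_INF_base)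
    show "D \<noteq> {}" using assms by (simp add: directed_set_def)
    fix i j assume ij: "i \<in> D" "j \<in> D"
    then obtain k where k: "k \<in> D" "le i k" "le j k"
      using assms unfolding directed_set_def by blast
    have "{m \<in> D. le k m} \<subseteq> {m \<in> D. le i m} \<inter> {m \<in> D. le j m}"
      using assms ij k unfolding directed_set_def by blast
    then show "\<exists>k\<in>D. principal {m \<in> D. le k m} \<le>
        inf (principal {m \<in> D. le i m}) (principal {m \<in> D. le j m})"
      using k(1) by (auto intro!: bexI[of _ k])
  qed
  then show ?thesis
    by (simp add: net_converges_def limitin_def eventually_principal Ball_def imp_conjL)
qed

text \<open>The index type below accommodates the pairs of a neighbourhood and a point in it; by
  \<open>isotropy_continuous_at_limitin\<close> the implication from left to right holds for every index type.\<close>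

lemma isotropy_continuous_at_iff_nets:
  fixes G :: "'a groupoid"
  shows
  "isotropy_continuous_at G u \<longleftrightarrow> u \<in> units G \<and>
    (\<forall>(D :: ('a set \<times> 'a) set) le x. directed_set D le \<longrightarrow> (\<forall>i\<in>D. x i \<in> units G) \<longrightarrow>
      net_converges (unit_space G) D le x u \<longrightarrow>
      net_converges (subgroup_space G) D le (\<lambda>i. isotropy G (x i)) (isotropy G u))"
  (is "_ \<longleftrightarrow> _ \<and> ?nets")
proof (intro iffI conjI)
  assume c: "isotropy_continuous_at G u"
  then show "u \<in> units G" by (simp add: isotropy_continuous_at_def)
  show ?nets
  proof (intro allI impI)
    fix D :: "('a set \<times> 'a) set" and le x
    assume D: "directed_set D le" and x: "net_converges (unit_space G) D le x u"
    show "net_converges (subgroup_space G) D le (\<lambda>i. isotropy G (x i)) (isotropy G u)"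
      using x isotropy_continuous_at_limitin[OF c] unfolding net_converges_limitin[OF D] by blast
  qed
next
  assume a: "u \<in> units G \<and> ?nets"
  have "limitin (subgroup_space G) (\<lambda>i. isotropy G (x i)) (isotropy G u) F"
    if lim: "limitin (unit_space G) x u F" for F :: "'a filter" and x
  proof -
    define D where "D = {(U, v). openin (unit_space G) U \<and> u \<in> U \<and> v \<in> U}"
    define le where "le = (\<lambda>(i :: 'a set \<times> 'a) (j :: 'a set \<times> 'a). fst j \<subseteq> fst i)"
    have u: "u \<in> topspace (unit_space G)" using lim by (simp add: limitin_def)
    have top: "(topspace (unit_space G), u) \<in> D" using u by (auto simp: D_def)
    have dir: "directed_set D le"
      unfolding directed_set_def
    proof (intro conjI ballI impI)
      show "D \<noteq> {}" using top by blast
      fix i j assume "i \<in> D" "j \<in> D"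
      then have "(fst i \<inter> fst j, u) \<in> D" by (auto simp: D_def)
      then show "\<exists>k\<in>D. le i k \<and> le j k"
        by (rule bexI[rotated]) (auto simp: le_def)
    qed (auto simp: le_def)
    have un: "\<forall>i\<in>D. snd i \<in> units G"
      using openin_subset by (fastforce simp: D_def unit_space_def)
    have conv: "net_converges (unit_space G) D le snd u"
      unfolding net_converges_def
    proof (intro conjI allI impI u)
      fix U assume "openin (unit_space G) U \<and> u \<in> U"
      then have "(U, u) \<in> D" by (simp add: D_def)
      then show "\<exists>i\<in>D. \<forall>j\<in>D. le i j \<longrightarrow> snd j \<in> U"
        by (rule bexI[rotated]) (auto simp: D_def le_def)
    qed
    have iso: "net_converges (subgroup_space G) D le (\<lambda>i. isotropy G (snd i)) (isotropy G u)"
      using a dir un conv by blast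
    show ?thesis
      unfolding limitin_def
    proof (intro conjI allI impI)
      show "isotropy G u \<in> topspace (subgroup_space G)" using iso by (simp add: net_converges_def)
      fix W assume "openin (subgroup_space G) W \<and> isotropy G u \<in> W"
      then obtain i where i: "i \<in> D" and W: "\<And>j. j \<in> D \<Longrightarrow> le i j \<Longrightarrow> isotropy G (snd j) \<in> W"
        using iso unfolding net_converges_def by meson
      have "isotropy G v \<in> W" if "v \<in> fst i" for v
        using W[of "(fst i, v)"] i that by (auto simp: D_def le_def)
      moreover have "\<forall>\<^sub>F k in F. x k \<in> fst i"
        using lim i unfolding limitin_def D_def by auto
      ultimately show "\<forall>\<^sub>F k in F. isotropy G (x k) \<in> W"
        by (rule eventually_mono[rotated])
    qed
  qed
  then show "isotropy_continuous_at G u" using a by (simp add: isotropy_continuous_at_def)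
qed

end

theory Submission
  imports Defs
begin

text \<open>For \<open>\<gamma>\<close> in the isotropy group at \<open>r w\<close> there is a unique \<open>\<eta>\<close> in the isotropy group at
  \<open>s w\<close> with \<open>\<gamma> \<cdot> w = w \<cdot> \<eta>\<close>, and this gives all isotropy elements at \<open>s w\<close>. Since the actions are
  free and proper and \<open>Z\<close> is locally compact Hausdorff, the maps \<open>(w, \<eta>) \<mapsto> (w, w \<cdot> \<eta>)\<close> and
  \<open>(\<gamma>, w) \<mapsto> (\<gamma> \<cdot> w, w)\<close> are embeddings, so \<open>\<eta>\<close> depends continuously on \<open>(\<gamma>, w)\<close> and \<open>\<gamma>\<close> on
  \<open>(w, \<eta>)\<close>. In a Hausdorff groupoid the bundle of isotropy groups is closed, so continuity at \<open>u\<close> only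
  means that an open set meeting the isotropy group at \<open>u\<close> meets the nearby ones as well. This is
  carried from one groupoid to the other because the moment maps are open.\<close>

section \<open>Injective maps with compact preimages as embeddings\<close>

text \<open>A locally compact Hausdorff space is a k-space in which compact sets are closed, so a
  continuous map into it with compact preimages of compact sets is closed. The complement of the
  image of \<open>topspace X - U\<close> is then open, and by injectivity it contains
  \<open>f x\<close>.\<close>

lemma compact_preimages_inj_neighbourhood:
  assumes f: "continuous_map X Y f" and p: "compact_preimages X Y f" and inj: "inj_on f (topspace X)"
    and lc: "locally_compact_space Y" and Y: "Hausdorff_space Y"
    and U: "openin X U" and x: "x \<in> U"
  obtains V where "openin Y V" "f x \<in> V" "\<And>x'. x' \<in> topspace X \<Longrightarrow> f x' \<in> V \<Longrightarrow> x' \<in> U"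
proof -
  have "proper_map X Y f"
    using p f by (intro compact_imp_proper_map locally_compact_imp_k_space Hausdorff_imp_kc_space
        lc Y continuous_map_funspace) (auto simp: compact_preimages_def)
  then have c: "closedin Y (f ` (topspace X - U))"
    using U by (simp add: proper_map_def closed_map_def closedin_diff)
  have "x \<in> topspace X" using U x openin_subset by blast
  then have "f x \<in> topspace Y - f ` (topspace X - U)"
    using f x inj by (auto simp: continuous_map_def inj_on_def)
  then show thesis
    by (intro that[of "topspace Y - f ` (topspace X - U)"]) (use c in auto)
qed

section \<open>Units and cancellation in groupoids\<close>

context groupoid
begin

lemma units_subset_arrows: "units G \<subseteq> arrows G"
  using rng_closed by (auto simp: units_def)

lemma rng_unit: "u \<in> units G \<Longrightarrow> rng G u = u"
  using rng_rng by (auto simp: units_def)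

lemma src_unit: "u \<in> units G \<Longrightarrow> src G u = u"
  using src_rng by (auto simp: units_def)

lemma topspace_unit_space: "topspace (unit_space G) = units G"
  using units_subset_arrows by (auto simp: unit_space_def arrows_def)

text \<open>Freeness only speaks of arrows that fix a point. This cancellation law, with its mirror
  image \<open>eq_of_inv_mul_eq_src\<close>, turns it into the equality of two arrows that move a
  point to the same place.\<close>

lemma eq_of_mul_inv_eq_rng:
  assumes "\<gamma> \<in> arrows G" "\<eta> \<in> arrows G" "src G \<gamma> = src G \<eta>" "mul G \<gamma> (ginv G \<eta>) = rng G \<eta>"
  shows "\<gamma> = \<eta>"
proof -
  have "\<gamma> = mul G \<gamma> (mul G (ginv G \<eta>) \<eta>)"
    using assms by (metis inv_mul mul_src_id)
  also have "\<dots> = mul G (mul G \<gamma> (ginv G \<eta>)) \<eta>"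
    using assms by (intro mul_assoc[symmetric]) (auto simp: composable_def inv_closed rng_inv src_inv)
  also have "\<dots> = \<eta>"
    using assms by (simp add: rng_mul_id)
  finally show ?thesis .
qed

lemma eq_of_inv_mul_eq_src:
  assumes "\<gamma> \<in> arrows G" "\<eta> \<in> arrows G" "rng G \<gamma> = rng G \<eta>" "mul G (ginv G \<eta>) \<gamma> = src G \<eta>"
  shows "\<gamma> = \<eta>"
proof -
  have "\<gamma> = mul G (mul G \<eta> (ginv G \<eta>)) \<gamma>"
    using assms by (metis mul_inv rng_mul_id)
  also have "\<dots> = mul G \<eta> (mul G (ginv G \<eta>) \<gamma>)"
    using assms by (intro mul_assoc) (auto simp: composable_def inv_closed rng_inv src_inv)
  also have "\<dots> = \<eta>"
    using assms by (simp add: mul_src_id)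
  finally show ?thesis .
qed

end

section \<open>Continuity of the isotropy in the Fell topology\<close>

context topological_groupoid
begin

context
  assumes Hausdorff: "Hausdorff_space (arrow_top G)"
begin

lemma Hausdorff_unit_space: "Hausdorff_space (unit_space G)"
  by (simp add: Hausdorff unit_space_def Hausdorff_space_subtopology)

lemma closedin_isotropy:
  assumes "u \<in> units G"
  shows "closedin (arrow_top G) (isotropy G u)"
proof -
  have "closedin (unit_space G) {u}"
    using assms Hausdorff_unit_space by (simp add: closedin_Hausdorff_sing_eq topspace_unit_space)
  then have "closedin (arrow_top G) ({\<gamma> \<in> topspace (arrow_top G). rng G \<gamma> \<in> {u}} \<inter>
      {\<gamma> \<in> topspace (arrow_top G). src G \<gamma> \<in> {u}})"
    by (intro closedin_Int closedin_continuous_map_preimage[OF continuous_rng]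
        closedin_continuous_map_preimage[OF continuous_src])
  also have "\<dots> = isotropy G u"
    by (auto simp: isotropy_def arrows_def)
  finally show ?thesis .
qed

lemma isotropy_in_closed_subgroups:
  assumes "u \<in> units G"
  shows "isotropy G u \<in> closed_subgroups G"
  unfolding closed_subgroups_def
proof (intro CollectI conjI bexI[OF _ assms] closedin_isotropy assms)
  show "u \<in> isotropy G u"
    using assms units_subset_arrows by (auto simp: isotropy_def rng_unit src_unit)
qed (auto simp: isotropy_def composable_def mul_closed rng_mul src_mul inv_closed rng_inv src_inv)

text \<open>The half of Fell convergence that concerns compact sets is automatic: the isotropy
  bundle \<open>I\<close> is closed, being the set where two continuous maps into a Hausdorff space
  agree.\<close>

lemma isotropy_avoids_compact:
  assumes K: "compactin (arrow_top G) K" and u: "u \<in> units G" and "isotropy G u \<inter> K = {}"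
  shows "\<exists>V. openin (unit_space G) V \<and> u \<in> V \<and> (\<forall>v\<in>V. isotropy G v \<inter> K = {})"
proof -
  define I where "I = {\<gamma> \<in> topspace (arrow_top G). rng G \<gamma> = src G \<gamma>}"
  have "closedin (arrow_top G) I"
    unfolding I_def
    by (rule closedin_continuous_maps_eq[OF Hausdorff_unit_space continuous_rng continuous_src])
  \<comment> \<open>The set \<open>rng G\<close> followed by the image of
    \<open>K \<inter> I\<close> consists of the units whose isotropy group meets \<open>K\<close>;
    compactness makes it closed, so its complement serves as \<open>V\<close>.\<close>
  then have "compactin (unit_space G) (rng G ` (K \<inter> I))"
    using K continuous_rng by (intro image_compactin[of "arrow_top G"] compact_Int_closedin)
  then have "closedin (unit_space G) (rng G ` (K \<inter> I))"
    using Hausdorff_unit_space compactin_imp_closedin by blast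
  then have "openin (unit_space G) (units G - rng G ` (K \<inter> I))"
    by (metis openin_diff openin_topspace topspace_unit_space)
  moreover have "u \<in> units G - rng G ` (K \<inter> I)"
    using assms by (auto simp: I_def isotropy_def arrows_def)
  moreover have "isotropy G v \<inter> K = {}" if "v \<in> units G - rng G ` (K \<inter> I)" for v
    using that by (force simp: I_def isotropy_def arrows_def)
  ultimately show ?thesis by blast
qed

text \<open>By \<open>isotropy_avoids_compact\<close> only the sets that are to be met impose a
  condition, and these can be treated one at a time because each generator involves finitely
  many.\<close>

lemma isotropy_continuous_at_iff:
  assumes u: "u \<in> units G"
  shows "isotropy_continuous_at G u \<longleftrightarrow>
    (\<forall>U. openin (arrow_top G) U \<longrightarrow> isotropy G u \<inter> U \<noteq> {} \<longrightarrow>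
      (\<exists>V. openin (unit_space G) V \<and> u \<in> V \<and> (\<forall>v\<in>V. isotropy G v \<inter> U \<noteq> {})))"
  (is "_ \<longleftrightarrow> ?lower")
proof
  assume c: "isotropy_continuous_at G u"
  \<comment> \<open>Testing continuity on the neighbourhood filter of \<open>u\<close>, with the
    identity as net, turns an eventual statement into one about a single open set
    \<open>V\<close>.\<close>
  have "limitin (unit_space G) (\<lambda>v. v) u (nhdsin (unit_space G) u)"
    using u by (auto simp: limitin_def eventually_nhdsin topspace_unit_space)
  then have lim: "limitin (fell_topology (arrow_top G)) (isotropy G) (isotropy G u)
      (nhdsin (unit_space G) u)"
    using isotropy_continuous_at_limitin[OF c] by (fastforce simp: subgroup_space_def limitin_subtopology)
  show ?lower
  proof (intro allI impI)
    fix U assume U: "openin (arrow_top G) U" "isotropy G u \<inter> U \<noteq> {}"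
    \<comment> \<open>This is the generator with empty compact set and the single open set
      \<open>U\<close>, kept in unsimplified form to match the generating family.\<close>
    define W where "W = {F. closedin (arrow_top G) F \<and> F \<inter> {} = {} \<and> (\<forall>U'\<in>{U}. F \<inter> U' \<noteq> {})}"
    have "openin (fell_topology (arrow_top G)) W"
      unfolding fell_topology_def W_def
      by (intro topology_generated_by_Basis CollectI exI[of _ "{}"] exI[of _ "{U}"]) (simp add: U)
    moreover have "isotropy G u \<in> W"
      using U closedin_isotropy[OF u] by (simp add: W_def)
    ultimately have "\<forall>\<^sub>F v in nhdsin (unit_space G) u. isotropy G v \<in> W"
      using lim by (simp add: limitin_def)
    then show "\<exists>V. openin (unit_space G) V \<and> u \<in> V \<and> (\<forall>v\<in>V. isotropy G v \<inter> U \<noteq> {})"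
      using u by (auto simp: eventually_nhdsin topspace_unit_space W_def)
  qed
next
  assume l: ?lower
  show "isotropy_continuous_at G u"
    unfolding isotropy_continuous_at_def
  proof (intro conjI allI impI u)
    fix F :: "'a filter" and x
    assume x: "limitin (unit_space G) x u F"
    have near: "\<forall>\<^sub>F i in F. x i \<in> V" if "openin (unit_space G) V" "u \<in> V" for V
      using x that by (simp add: limitin_def)
    \<comment> \<open>\<open>limitin\<close> constrains \<open>x\<close> only eventually, so values
      outside the unit space are discarded before their isotropy sets are treated as closed
      subgroups.\<close>
    have units: "\<forall>\<^sub>F i in F. x i \<in> units G"
      using near[OF openin_topspace] u by (simp add: topspace_unit_space)
    \<comment> \<open>The Fell topology is given by generators, so the argument is an induction on
      how \<open>W\<close> is generated; unions and binary intersections preserve the claim, and the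
      generators carry the content.\<close>
    have "\<forall>\<^sub>F i in F. isotropy G (x i) \<in> W"
      if "generate_topology_on {{A. closedin (arrow_top G) A \<and> A \<inter> K = {} \<and> (\<forall>U\<in>\<U>. A \<inter> U \<noteq> {})} | K \<U>.
          compactin (arrow_top G) K \<and> finite \<U> \<and> (\<forall>U\<in>\<U>. openin (arrow_top G) U)} W"
        "isotropy G u \<in> W" for W
      using that
    proof induction
      case (UN \<W>)
      then obtain W where "W \<in> \<W>" "isotropy G u \<in> W" by blast
      then have "\<forall>\<^sub>F i in F. isotropy G (x i) \<in> W" using UN by blast
      then show ?case by (rule eventually_mono) (use \<open>W \<in> \<W>\<close> in blast)
    next
      case (Basis W)
      then obtain K \<U> where K: "compactin (arrow_top G) K" and fin: "finite \<U>"
        and op: "\<And>U. U \<in> \<U> \<Longrightarrow> openin (arrow_top G) U"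
        and W: "W = {A. closedin (arrow_top G) A \<and> A \<inter> K = {} \<and> (\<forall>U\<in>\<U>. A \<inter> U \<noteq> {})}"
        by blast
      have uW: "isotropy G u \<inter> K = {}" "\<And>U. U \<in> \<U> \<Longrightarrow> isotropy G u \<inter> U \<noteq> {}"
        using Basis(2) by (simp_all add: W)
      obtain V where "openin (unit_space G) V" "u \<in> V" and V: "\<And>v. v \<in> V \<Longrightarrow> isotropy G v \<inter> K = {}"
        using isotropy_avoids_compact[OF K u uW(1)] by blast
      then have "\<forall>\<^sub>F i in F. x i \<in> V"
        using near by blast
      then have "\<forall>\<^sub>F i in F. isotropy G (x i) \<inter> K = {}"
        by (rule eventually_mono) (rule V)
      moreover have "\<forall>\<^sub>F i in F. \<forall>U\<in>\<U>. isotropy G (x i) \<inter> U \<noteq> {}"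
      proof (rule eventually_ball_finite[OF fin], rule ballI)
        fix U assume "U \<in> \<U>"
        then obtain V where "openin (unit_space G) V" "u \<in> V"
          and V: "\<And>v. v \<in> V \<Longrightarrow> isotropy G v \<inter> U \<noteq> {}"
          using l op uW(2) by meson
        then have "\<forall>\<^sub>F i in F. x i \<in> V"
          using near by blast
        then show "\<forall>\<^sub>F i in F. isotropy G (x i) \<inter> U \<noteq> {}"
          by (rule eventually_mono) (rule V)
      qed
      ultimately show ?case
        using units by eventually_elim (simp add: W closedin_isotropy)
    qed (auto intro: eventually_conj)
    then have "limitin (fell_topology (arrow_top G)) (\<lambda>i. isotropy G (x i)) (isotropy G u) F"
      unfolding limitin_def topspace_fell_topology
      by (simp add: fell_topology_def openin_topology_generated_by_iff closedin_isotropy u)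
    moreover have "\<forall>\<^sub>F i in F. isotropy G (x i) \<in> closed_subgroups G"
      using units by (rule eventually_mono) (rule isotropy_in_closed_subgroups)
    ultimately show "limitin (subgroup_space G) (\<lambda>i. isotropy G (x i)) (isotropy G u) F"
      by (simp add: subgroup_space_def limitin_subtopology isotropy_in_closed_subgroups u)
  qed
qed

end

end

section \<open>Free actions, orbits and fibre products\<close>

text \<open>If \<gamma> and \<eta> move \<open>p\<close> to the same point, the moment of that point
  shows that their ranges agree. Hence the product of the inverse of \<eta> with \<gamma> is defined
  and fixes \<open>p\<close>, so it is a unit by freeness.\<close>

lemma (in free_proper_left_action) inj_on_act:
  assumes "groupoid G"
  shows "inj_on (\<lambda>(\<gamma>, p). (act \<gamma> p, p)) (topspace (left_fibre_product G P \<rho>))"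
proof -
  interpret groupoid G by fact
  have "\<gamma> = \<eta>"
    if g: "\<gamma> \<in> arrows G" "\<eta> \<in> arrows G" and p: "p \<in> topspace P"
      and src: "src G \<gamma> = \<rho> p" "src G \<eta> = \<rho> p" and eq: "act \<gamma> p = act \<eta> p" for \<gamma> \<eta> p
  proof -
    have r: "rng G \<gamma> = rng G \<eta>"
      using moment_act[of _ p] that by metis
    have i: "ginv G \<eta> \<in> arrows G" "src G (ginv G \<eta>) = rng G \<eta>" "rng G (ginv G \<eta>) = \<rho> p"
      using g src by (auto simp: inv_closed src_inv rng_inv)
    have c: "(ginv G \<eta>, \<gamma>) \<in> composable G" "(ginv G \<eta>, \<eta>) \<in> composable G"
      using i g r by (auto simp: composable_def)
    have "act (mul G (ginv G \<eta>) \<gamma>) p = act (mul G (ginv G \<eta>) \<eta>) p"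
      using act_mul c p src eq by metis
    also have "\<dots> = p"
      using g src p by (simp add: inv_mul act_unit)
    finally have m: "act (mul G (ginv G \<eta>) \<gamma>) p = p" .
    have "src G (mul G (ginv G \<eta>) \<gamma>) = \<rho> p"
      using src_mul[OF c(1)] src(1) by (rule trans)
    then have "mul G (ginv G \<eta>) \<gamma> = \<rho> p"
      by (rule free[OF mul_closed[OF c(1)] p _ m])
    then show ?thesis
      unfolding src(2)[symmetric] by (rule eq_of_inv_mul_eq_src[OF g r])
  qed
  then show ?thesis
    by (auto simp: inj_on_def left_fibre_product_def arrows_def)
qed

text \<open>Mirror image of the left case: here the product of \<gamma> with the inverse of \<eta>
  fixes \<open>p\<close>.\<close>

lemma (in free_proper_right_action) inj_on_act:
  assumes "groupoid H"
  shows "inj_on (\<lambda>(p, \<eta>). (p, act p \<eta>)) (topspace (right_fibre_product H P \<sigma>))"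
proof -
  interpret groupoid H by fact
  have "\<gamma> = \<eta>"
    if g: "\<gamma> \<in> arrows H" "\<eta> \<in> arrows H" and p: "p \<in> topspace P"
      and rng: "\<sigma> p = rng H \<gamma>" "\<sigma> p = rng H \<eta>" and eq: "act p \<gamma> = act p \<eta>" for \<gamma> \<eta> p
  proof -
    have r: "src H \<gamma> = src H \<eta>"
      using moment_act[of _ p] that by metis
    have i: "ginv H \<eta> \<in> arrows H" "rng H (ginv H \<eta>) = src H \<eta>" "src H (ginv H \<eta>) = \<sigma> p"
      using g rng by (auto simp: inv_closed src_inv rng_inv)
    have c: "(\<gamma>, ginv H \<eta>) \<in> composable H" "(\<eta>, ginv H \<eta>) \<in> composable H"
      using i g r by (auto simp: composable_def)
    have "act p (mul H \<gamma> (ginv H \<eta>)) = act p (mul H \<eta> (ginv H \<eta>))"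
      using act_mul c p rng eq by metis
    also have "\<dots> = p"
      using g rng p by (metis mul_inv act_unit)
    finally have m: "act p (mul H \<gamma> (ginv H \<eta>)) = p" .
    have "\<sigma> p = rng H (mul H \<gamma> (ginv H \<eta>))"
      using rng(1) rng_mul[OF c(1), symmetric] by (rule trans)
    then have "mul H \<gamma> (ginv H \<eta>) = \<sigma> p"
      by (rule free[OF mul_closed[OF c(1)] p _ m])
    then show ?thesis
      unfolding rng(2) by (rule eq_of_mul_inv_eq_rng[OF g r])
  qed
  then show ?thesis
    by (auto simp: inj_on_def right_fibre_product_def arrows_def)
qed

text \<open>The induced homeomorphism is injective on classes. For the moment maps of an
  equivalence, this puts points with equal moment into one orbit of the other groupoid.\<close>

lemma induces_homeomorphism_fibre:
  assumes "induces_homeomorphism X q Y f" "x \<in> topspace X" "y \<in> topspace X" "f x = f y"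
  shows "q x = q y"
proof -
  obtain g where g: "homeomorphic_map (quotient_topology X q) Y g" "\<forall>x \<in> topspace X. g (q x) = f x"
    using assms(1) unfolding induces_homeomorphism_def by blast
  have "inj_on g (q ` topspace X)"
    using homeomorphic_imp_injective_map[OF g(1)] by (simp add: topspace_quotient_topology)
  then show ?thesis
    using g(2) assms(2-4) by (metis imageI inj_onD)
qed

lemma openin_prod_rectangle:
  assumes "openin (subtopology (prod_topology X Y) S) W" "(x, y) \<in> W"
  obtains A B where "openin X A" "openin Y B" "x \<in> A" "y \<in> B" "(A \<times> B) \<inter> S \<subseteq> W"
proof -
  obtain T where T: "openin (prod_topology X Y) T" "W = T \<inter> S"
    using assms(1) by (auto simp: openin_subtopology)
  have "(x, y) \<in> T"
    using assms(2) T(2) by simp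
  then obtain A B where "openin X A" "openin Y B" "x \<in> A" "y \<in> B" "A \<times> B \<subseteq> T"
    using T(1) unfolding openin_prod_topology_alt by meson
  then show thesis
    using T(2) by (intro that[of A B]) auto
qed

lemma (in left_action) act_in_topspace:
  assumes "\<gamma> \<in> arrows G" "p \<in> topspace P" "src G \<gamma> = \<rho> p"
  shows "act \<gamma> p \<in> topspace P"
proof -
  have "(\<gamma>, p) \<in> topspace (left_fibre_product G P \<rho>)"
    using assms by (simp add: left_fibre_product_def arrows_def)
  then show ?thesis
    using Pi_mem[OF continuous_map_funspace[OF act_continuous]] by fastforce
qed

lemma (in right_action) act_in_topspace:
  assumes "\<eta> \<in> arrows H" "p \<in> topspace P" "\<sigma> p = rng H \<eta>"
  shows "act p \<eta> \<in> topspace P"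
proof -
  have "(p, \<eta>) \<in> topspace (right_fibre_product H P \<sigma>)"
    using assms by (simp add: right_fibre_product_def arrows_def)
  then show ?thesis
    using Pi_mem[OF continuous_map_funspace[OF act_continuous]] by fastforce
qed

lemma (in left_action) continuous_map_act_pair:
  "continuous_map (left_fibre_product G P \<rho>) (prod_topology P P) (\<lambda>(\<gamma>, p). (act \<gamma> p, p))"
proof -
  have "continuous_map (left_fibre_product G P \<rho>) P snd"
    unfolding left_fibre_product_def
    by (intro continuous_map_from_subtopology continuous_map_snd)
  then show ?thesis
    using act_continuous by (simp add: continuous_map_pairwise o_def case_prod_unfold)
qed

lemma (in right_action) continuous_map_act_pair:
  "continuous_map (right_fibre_product H P \<sigma>) (prod_topology P P) (\<lambda>(p, \<eta>). (p, act p \<eta>))"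
proof -
  have "continuous_map (right_fibre_product H P \<sigma>) P fst"
    unfolding right_fibre_product_def
    by (intro continuous_map_from_subtopology continuous_map_fst)
  then show ?thesis
    using act_continuous by (simp add: continuous_map_pairwise o_def case_prod_unfold)
qed

section \<open>Corresponding isotropy elements in an equivalence\<close>

context groupoid_equivalence
begin

lemma r_in_units: "groupoid G \<Longrightarrow> z \<in> topspace Z \<Longrightarrow> r z \<in> units G"
  using left.moment_continuous groupoid.topspace_unit_space by (fastforce simp: continuous_map_def)

lemma s_in_units: "groupoid H \<Longrightarrow> z \<in> topspace Z \<Longrightarrow> s z \<in> units H"
  using right.moment_continuous groupoid.topspace_unit_space by (fastforce simp: continuous_map_def)

text \<open>Acting by an isotropy element keeps \<open>r w\<close>, so the new point stays in the
  \<open>H\<close>-orbit of \<open>w\<close> and has the form \<open>ract w \<eta>\<close>.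
  Invariance of \<open>s\<close> under \<open>G\<close> then forces the source of \<eta> to be
  \<open>s w\<close>.\<close>

lemma ex_right_isotropy:
  assumes H: "groupoid H" and w: "w \<in> topspace Z" and g: "\<gamma> \<in> isotropy G (r w)"
  obtains \<eta> where "\<eta> \<in> isotropy H (s w)" "lact \<gamma> w = ract w \<eta>"
proof -
  interpret H: groupoid H by fact
  have g': "\<gamma> \<in> arrows G" "src G \<gamma> = r w" "rng G \<gamma> = r w"
    using g by (auto simp: isotropy_def)
  have gw: "lact \<gamma> w \<in> topspace Z"
    using left.act_in_topspace w g' by simp
  have "r (lact \<gamma> w) = r w"
    using left.moment_act g' w by simp
  then have orb: "right_orbit H s ract (lact \<gamma> w) = right_orbit H s ract w"
    using induces_homeomorphism_fibre[OF r_homeomorphism gw w] by blast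
  \<comment> \<open>Each point lies in its own orbit through the action of a unit; the equality of
    orbits then yields the arrow \<eta>.\<close>
  have "lact \<gamma> w \<in> right_orbit H s ract (lact \<gamma> w)"
    unfolding right_orbit_def
    using right.act_unit[OF gw] s_in_units[OF H gw] H.units_subset_arrows H.rng_unit
    by (intro CollectI exI[of _ "s (lact \<gamma> w)"]) auto
  then obtain \<eta> where e: "\<eta> \<in> arrows H" "s w = rng H \<eta>" "lact \<gamma> w = ract w \<eta>"
    unfolding orb by (auto simp: right_orbit_def)
  have "src H \<eta> = s w"
    using right.moment_act e w s_invariant g' by metis
  then show thesis
    using e by (intro that[of \<eta>]) (auto simp: isotropy_def)
qed

text \<open>The same argument with the two sides exchanged, using that \<open>s\<close> separates
  \<open>G\<close>-orbits and that \<open>r\<close> is invariant under \<open>H\<close>.\<close>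

lemma ex_left_isotropy:
  assumes G: "groupoid G" and w: "w \<in> topspace Z" and h: "\<eta> \<in> isotropy H (s w)"
  obtains \<gamma> where "\<gamma> \<in> isotropy G (r w)" "lact \<gamma> w = ract w \<eta>"
proof -
  interpret G: groupoid G by fact
  have h': "\<eta> \<in> arrows H" "src H \<eta> = s w" "rng H \<eta> = s w"
    using h by (auto simp: isotropy_def)
  have wh: "ract w \<eta> \<in> topspace Z"
    using right.act_in_topspace w h' by simp
  have "s (ract w \<eta>) = s w"
    using right.moment_act h' w by simp
  then have orb: "left_orbit G r lact (ract w \<eta>) = left_orbit G r lact w"
    using induces_homeomorphism_fibre[OF s_homeomorphism wh w] by blast
  have "ract w \<eta> \<in> left_orbit G r lact (ract w \<eta>)"
    unfolding left_orbit_def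
    using left.act_unit[OF wh] r_in_units[OF G wh] G.units_subset_arrows G.src_unit
    by (intro CollectI exI[of _ "r (ract w \<eta>)"]) auto
  then obtain \<gamma> where e: "\<gamma> \<in> arrows G" "src G \<gamma> = r w" "ract w \<eta> = lact \<gamma> w"
    unfolding orb by (auto simp: left_orbit_def)
  have "rng G \<gamma> = r w"
    using left.moment_act e w r_invariant h' by metis
  then show thesis
    using e by (intro that[of \<gamma>]) (auto simp: isotropy_def)
qed

lemma locally_compact_Hausdorff_square:
  "locally_compact_space (prod_topology Z Z)" "Hausdorff_space (prod_topology Z Z)"
  using locally_compact Hausdorff
  by (auto simp: locally_compact_space_prod_topology Hausdorff_space_prod_topology)

text \<open>Neighbourhood form of the continuous dependence of \<eta> on the pair of \<gamma> and
  \<open>w\<close> in the relation \<open>lact \<gamma> w = ract w \<eta>\<close>.\<close>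

lemma right_isotropy_near:
  assumes H: "groupoid H" and z: "z \<in> topspace Z"
    and g: "\<gamma> \<in> isotropy G (r z)" and h: "\<eta> \<in> isotropy H (s z)" and eq: "lact \<gamma> z = ract z \<eta>"
    and U: "openin (arrow_top H) U" "\<eta> \<in> U"
  obtains N W where "openin (arrow_top G) N" "\<gamma> \<in> N" "openin Z W" "z \<in> W"
    "\<And>w. w \<in> W \<Longrightarrow> isotropy G (r w) \<inter> N \<noteq> {} \<Longrightarrow> isotropy H (s w) \<inter> U \<noteq> {}"
proof -
  let ?R = "right_fibre_product H Z s" and ?L = "left_fibre_product G Z r"
  define U' where "U' = (topspace Z \<times> U) \<inter> {(p, \<eta>). s p = rng H \<eta>}"
  have "openin ?R U'"
    unfolding U'_def right_fibre_product_def
    using U by (intro openin_subtopology_Int) (simp add: openin_prod_Times_iff)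
  moreover have "(z, \<eta>) \<in> U'"
    using z U h by (auto simp: U'_def isotropy_def)
  ultimately obtain V where V: "openin (prod_topology Z Z) V" "(z, ract z \<eta>) \<in> V"
    "\<And>x. x \<in> topspace ?R \<Longrightarrow> (\<lambda>(p, \<eta>). (p, ract p \<eta>)) x \<in> V \<Longrightarrow> x \<in> U'"
    using compact_preimages_inj_neighbourhood[OF right.continuous_map_act_pair right.proper
        right.inj_on_act[OF H] locally_compact_Hausdorff_square, of U' "(z, \<eta>)"] by auto
  \<comment> \<open>The coordinates of the left pairing are swapped to match
    \<open>(p, ract p \<eta>)\<close>. Corresponding isotropy elements then give the same point of
    the square of \<open>Z\<close>, so \<open>V\<close> can be pulled back along the left
    action.\<close>
  define M where "M = {x \<in> topspace ?L. (\<lambda>(\<gamma>, p). (p, lact \<gamma> p)) x \<in> V}"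
  have "continuous_map ?L (prod_topology Z Z) (\<lambda>(\<gamma>, p). (p, lact \<gamma> p))"
    using left.continuous_map_act_pair by (simp add: continuous_map_pairwise o_def case_prod_unfold)
  then have "openin ?L M"
    unfolding M_def using V(1) by (rule openin_continuous_map_preimage)
  moreover have "(\<gamma>, z) \<in> M"
    using z g V(2) eq by (auto simp: M_def left_fibre_product_def isotropy_def arrows_def)
  ultimately obtain N W where NW: "openin (arrow_top G) N" "openin Z W" "\<gamma> \<in> N" "z \<in> W"
    "(N \<times> W) \<inter> {(\<gamma>, p). src G \<gamma> = r p} \<subseteq> M"
    unfolding left_fibre_product_def by (rule openin_prod_rectangle)
  have "isotropy H (s w) \<inter> U \<noteq> {}" if w: "w \<in> W" and ne: "isotropy G (r w) \<inter> N \<noteq> {}" for w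
  proof -
    obtain \<gamma>' where g': "\<gamma>' \<in> isotropy G (r w)" "\<gamma>' \<in> N"
      using ne by blast
    have wZ: "w \<in> topspace Z" using w NW(2) openin_subset by blast
    obtain \<eta>' where h': "\<eta>' \<in> isotropy H (s w)" "lact \<gamma>' w = ract w \<eta>'"
      using ex_right_isotropy[OF H wZ g'(1)] .
    have "(\<gamma>', w) \<in> M"
      using NW(5) w g' by (auto simp: isotropy_def)
    \<comment> \<open>The pair \<open>(w, ract w \<eta>')\<close> equals
      \<open>(w, lact \<gamma>' w)\<close> and so lies in \<open>V\<close>, which by the choice of
      \<open>V\<close> places \<eta>' in \<open>U\<close>.\<close>
    then have "(w, \<eta>') \<in> U'"
      using h' wZ by (intro V(3)) (auto simp: M_def right_fibre_product_def isotropy_def arrows_def)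
    then show ?thesis
      using h' by (auto simp: U'_def)
  qed
  then show thesis
    using that[OF NW(1,3,2,4)] by blast
qed

text \<open>Continuous dependence in the other direction, of \<gamma> on \<open>w\<close> and
  \<eta>, obtained from properness and freeness of the left action.\<close>

lemma left_isotropy_near:
  assumes G: "groupoid G" and z: "z \<in> topspace Z"
    and g: "\<gamma> \<in> isotropy G (r z)" and h: "\<eta> \<in> isotropy H (s z)" and eq: "lact \<gamma> z = ract z \<eta>"
    and U: "openin (arrow_top G) U" "\<gamma> \<in> U"
  obtains N W where "openin (arrow_top H) N" "\<eta> \<in> N" "openin Z W" "z \<in> W"
    "\<And>w. w \<in> W \<Longrightarrow> isotropy H (s w) \<inter> N \<noteq> {} \<Longrightarrow> isotropy G (r w) \<inter> U \<noteq> {}"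
proof -
  let ?R = "right_fibre_product H Z s" and ?L = "left_fibre_product G Z r"
  define U' where "U' = (U \<times> topspace Z) \<inter> {(\<gamma>, p). src G \<gamma> = r p}"
  have "openin ?L U'"
    unfolding U'_def left_fibre_product_def
    using U by (intro openin_subtopology_Int) (simp add: openin_prod_Times_iff)
  moreover have "(\<gamma>, z) \<in> U'"
    using z U g by (auto simp: U'_def isotropy_def)
  ultimately obtain V where V: "openin (prod_topology Z Z) V" "(lact \<gamma> z, z) \<in> V"
    "\<And>x. x \<in> topspace ?L \<Longrightarrow> (\<lambda>(\<gamma>, p). (lact \<gamma> p, p)) x \<in> V \<Longrightarrow> x \<in> U'"
    using compact_preimages_inj_neighbourhood[OF left.continuous_map_act_pair left.proper
        left.inj_on_act[OF G] locally_compact_Hausdorff_square, of U' "(\<gamma>, z)"] by auto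
  \<comment> \<open>Now the right pairing is the one that is swapped, to match
    \<open>(lact \<gamma> p, p)\<close>.\<close>
  define M where "M = {x \<in> topspace ?R. (\<lambda>(p, \<eta>). (ract p \<eta>, p)) x \<in> V}"
  have "continuous_map ?R (prod_topology Z Z) (\<lambda>(p, \<eta>). (ract p \<eta>, p))"
    using right.continuous_map_act_pair by (simp add: continuous_map_pairwise o_def case_prod_unfold)
  then have "openin ?R M"
    unfolding M_def using V(1) by (rule openin_continuous_map_preimage)
  moreover have "(z, \<eta>) \<in> M"
    using z h V(2) eq by (auto simp: M_def right_fibre_product_def isotropy_def arrows_def)
  ultimately obtain W N where NW: "openin Z W" "openin (arrow_top H) N" "z \<in> W" "\<eta> \<in> N"
    "(W \<times> N) \<inter> {(p, \<eta>). s p = rng H \<eta>} \<subseteq> M"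
    unfolding right_fibre_product_def by (rule openin_prod_rectangle)
  have "isotropy G (r w) \<inter> U \<noteq> {}" if w: "w \<in> W" and ne: "isotropy H (s w) \<inter> N \<noteq> {}" for w
  proof -
    obtain \<eta>' where h': "\<eta>' \<in> isotropy H (s w)" "\<eta>' \<in> N"
      using ne by blast
    have wZ: "w \<in> topspace Z" using w NW(1) openin_subset by blast
    obtain \<gamma>' where g': "\<gamma>' \<in> isotropy G (r w)" "lact \<gamma>' w = ract w \<eta>'"
      using ex_left_isotropy[OF G wZ h'(1)] .
    have "(w, \<eta>') \<in> M"
      using NW(5) w h' by (auto simp: isotropy_def)
    then have "(\<gamma>', w) \<in> U'"
      using g' wZ by (intro V(3)) (auto simp: M_def left_fibre_product_def isotropy_def arrows_def)
    then show ?thesis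
      using g' by (auto simp: U'_def)
  qed
  then show thesis
    using that[OF NW(2,4,1,3)] by blast
qed

end

section \<open>Transfer of continuity along open moment maps\<close>

text \<open>Stated for two maps \<open>f\<close> and \<open>g\<close> without reference to the
  actions, so that one argument covers both implications. The hypothesis \<open>near\<close> carries
  what the equivalence contributes.\<close>

lemma isotropy_continuous_at_transfer:
  assumes G: "topological_groupoid G" "Hausdorff_space (arrow_top G)"
    and H: "topological_groupoid H" "Hausdorff_space (arrow_top H)"
    and f: "continuous_map Z (unit_space G) f" and g: "continuous_map Z (unit_space H) g"
    and g_open: "open_map Z (unit_space H) g" and z: "z \<in> topspace Z"
    and near: "\<And>\<eta> U. \<eta> \<in> isotropy H (g z) \<Longrightarrow> openin (arrow_top H) U \<Longrightarrow> \<eta> \<in> U \<Longrightarrow>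
      \<exists>\<gamma> N W. \<gamma> \<in> isotropy G (f z) \<and> openin (arrow_top G) N \<and> \<gamma> \<in> N \<and> openin Z W \<and> z \<in> W \<and>
        (\<forall>w\<in>W. isotropy G (f w) \<inter> N \<noteq> {} \<longrightarrow> isotropy H (g w) \<inter> U \<noteq> {})"
    and c: "isotropy_continuous_at G (f z)"
  shows "isotropy_continuous_at H (g z)"
proof -
  interpret G: topological_groupoid G by fact
  interpret H: topological_groupoid H by fact
  have fz: "f z \<in> units G"
    using f z G.topspace_unit_space by (fastforce simp: continuous_map_def)
  have gz: "g z \<in> units H"
    using g z H.topspace_unit_space by (fastforce simp: continuous_map_def)
  show ?thesis
    unfolding H.isotropy_continuous_at_iff[OF H(2) gz]
  proof (intro allI impI)
    fix U assume U: "openin (arrow_top H) U" "isotropy H (g z) \<inter> U \<noteq> {}"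
    then obtain \<gamma> N W where N: "\<gamma> \<in> isotropy G (f z)" "openin (arrow_top G) N" "\<gamma> \<in> N"
      and W: "openin Z W" "z \<in> W"
      and NW: "\<And>w. w \<in> W \<Longrightarrow> isotropy G (f w) \<inter> N \<noteq> {} \<Longrightarrow> isotropy H (g w) \<inter> U \<noteq> {}"
      using near by (metis disjoint_iff)
    obtain V where V: "openin (unit_space G) V" "f z \<in> V" "\<And>v. v \<in> V \<Longrightarrow> isotropy G v \<inter> N \<noteq> {}"
      using c N unfolding G.isotropy_continuous_at_iff[OF G(2) fz] by (metis disjoint_iff)
    \<comment> \<open>On \<open>W'\<close> continuity for \<open>G\<close> makes the isotropy group
      at \<open>f w\<close> meet \<open>N\<close>, and \<open>near\<close> passes this on to
      \<open>U\<close>. Openness of \<open>g\<close> makes the image of \<open>W'\<close> the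
      required neighbourhood of \<open>g z\<close>.\<close>
    define W' where "W' = W \<inter> {w \<in> topspace Z. f w \<in> V}"
    have "openin Z W'"
      unfolding W'_def using W(1) openin_continuous_map_preimage[OF f V(1)] by blast
    then have "openin (unit_space H) (g ` W')"
      using g_open by (simp add: open_map_def)
    moreover have "g z \<in> g ` W'"
      using z W V by (auto simp: W'_def)
    ultimately show "\<exists>V. openin (unit_space H) V \<and> g z \<in> V \<and> (\<forall>v\<in>V. isotropy H v \<inter> U \<noteq> {})"
      using NW V(3) by (intro exI[of _ "g ` W'"]) (auto simp: W'_def)
  qed
qed

theorem proposition4p5:
  fixes G :: "'g groupoid" and H :: "'h groupoid" and Z :: "'z topology"
    and r :: "'z \<Rightarrow> 'g" and s :: "'z \<Rightarrow> 'h"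
    and lact :: "'g \<Rightarrow> 'z \<Rightarrow> 'z" and ract :: "'z \<Rightarrow> 'h \<Rightarrow> 'z" and z :: 'z
  assumes "topological_groupoid G"
    and "locally_compact_space (arrow_top G)" and "Hausdorff_space (arrow_top G)"
    and "open_map (arrow_top G) (unit_space G) (rng G)"
    and "open_map (arrow_top G) (unit_space G) (src G)"
    and "topological_groupoid H"
    and "locally_compact_space (arrow_top H)" and "Hausdorff_space (arrow_top H)"
    and "open_map (arrow_top H) (unit_space H) (rng H)"
    and "open_map (arrow_top H) (unit_space H) (src H)"
    and "groupoid_equivalence G H Z r s lact ract"
    and "z \<in> topspace Z"
  shows "isotropy_continuous_at G (r z) \<longleftrightarrow> isotropy_continuous_at H (s z)"
proof -
  interpret groupoid_equivalence G H Z r s lact ract by fact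
  have G: "groupoid G" and H: "groupoid H"
    using assms by (auto simp: topological_groupoid_def)
  note z = \<open>z \<in> topspace Z\<close>
  show ?thesis
  proof
    assume c: "isotropy_continuous_at G (r z)"
    show "isotropy_continuous_at H (s z)"
    proof (rule isotropy_continuous_at_transfer[OF assms(1,3,6,8) left.moment_continuous
          right.moment_continuous s_open z _ c])
      \<comment> \<open>The partner \<gamma> is found by going from \<open>H\<close> back to
        \<open>G\<close>, whereas the neighbourhoods come from the dependence of \<eta> on
        \<gamma>.\<close>
      fix \<eta> U assume h: "\<eta> \<in> isotropy H (s z)" and U: "openin (arrow_top H) U" "\<eta> \<in> U"
      obtain \<gamma> where g: "\<gamma> \<in> isotropy G (r z)" "lact \<gamma> z = ract z \<eta>"
        using ex_left_isotropy[OF G z h] .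
      from right_isotropy_near[OF H z g(1) h g(2) U] g(1)
      show "\<exists>\<gamma> N W. \<gamma> \<in> isotropy G (r z) \<and> openin (arrow_top G) N \<and> \<gamma> \<in> N \<and> openin Z W \<and> z \<in> W \<and>
          (\<forall>w\<in>W. isotropy G (r w) \<inter> N \<noteq> {} \<longrightarrow> isotropy H (s w) \<inter> U \<noteq> {})"
        by metis
    qed
  next
    assume c: "isotropy_continuous_at H (s z)"
    show "isotropy_continuous_at G (r z)"
    proof (rule isotropy_continuous_at_transfer[OF assms(6,8,1,3) right.moment_continuous
          left.moment_continuous r_open z _ c])
      fix \<gamma> U assume g: "\<gamma> \<in> isotropy G (r z)" and U: "openin (arrow_top G) U" "\<gamma> \<in> U"
      obtain \<eta> where h: "\<eta> \<in> isotropy H (s z)" "lact \<gamma> z = ract z \<eta>"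
        using ex_right_isotropy[OF H z g] .
      from left_isotropy_near[OF G z g h U] h(1)
      show "\<exists>\<eta> N W. \<eta> \<in> isotropy H (s z) \<and> openin (arrow_top H) N \<and> \<eta> \<in> N \<and> openin Z W \<and> z \<in> W \<and>
          (\<forall>w\<in>W. isotropy H (s w) \<inter> N \<noteq> {} \<longrightarrow> isotropy G (r w) \<inter> U \<noteq> {})"
        by metis
    qed
  qed
qed

end
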